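(* Let $S$, $A$, $S'$ be random variables jointly following some coverage transition distribution, and let $T$ be the transition model of the corresponding environment. For reward functions $R_A, R_B: \mathcal{S}\times\mathcal{A}\times\mathcal{S}\to\mathbb{R}$ define $$D_{\mathrm{DARD}}(R_A, R_B) = D_{\rho}\Big( C_T(R_A)(S, A, S'),\; C_T(R_B)(S, A, S') \Big),$$ where $D_\rho$ is the Pearson distance and $C_T$ is the dynamics-aware transformation. Then $D_{\mathrm{DARD}}$ is a pseudometric. That is, for all reward functions $R_A, R_B, R_C:\mathcal{S}\times\mathcal{A}\times\mathcal{S}\to\mathbb{R}$: $D_{\mathrm{DARD}}(R_A,R_A)=0$; $D_{\mathrm{DARD}}(R_A,R_B)=D_{\mathrm{DARD}}(R_B,R_A)$; and $D_{\mathrm{DARD}}(R_A,R_C)\le D_{\mathrm{DARD}}(R_A,R_B)+D_{\mathrm{DARD}}(R_B,R_C)$.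
   Context: $\mathcal{S}$ and $\mathcal{A}$ are the state and action spaces of a Markov decision process with discount factor $\gamma\in[0,1]$; $\Delta(\mathcal{X})$ denotes the set of distributions over $\mathcal{X}$. A reward function is a function $R:\mathcal{S}\times\mathcal{A}\times\mathcal{S}\to\mathbb{R}$. A coverage transition distribution is a distribution over transitions (state, action, next state) in $\mathcal{S}\times\mathcal{A}\times\mathcal{S}$. The transition model $T$ maps a state and an action to a probability distribution $T(\cdot\mid s,a)$ over next states. Dynamics-aware transformation. Given a distribution $\mathcal{D}_{\mathcal{A}}\in\Delta(\mathcal{A})$ over actions, let $\tilde A$ be a random variable distributed as $\mathcal{D}_{\mathcal{A}}$, and, for given $s,s'\in\mathcal{S}$, let $\tilde S'$ and $\tilde S''$ be random variables distributed as $T(\cdot\mid s,\tilde A)$ and $T(\cdot\mid s',\tilde A)$ respectively. The dynamics-aware transformation of a reward function $R$ is $$C_T(R)(s,a,s') = R(s,a,s') + \mathbb{E}\big[\gamma R(s',\tilde A,\tilde S'') - R(s,\tilde A,\tilde S') - \gamma R(\tilde S',\tilde A,\tilde S'')\big],$$ where $s,a,s'$ are fixed and the expectation is over $\tilde A,\tilde S',\tilde S''$. $C_T(R)(S,A,S')$ is this function evaluated at the random transition $(S,A,S')$. Pearson distance. For random variables $X,Y$, $D_\rho(X,Y) = \sqrt{1-\rho(X,Y)}/\sqrt{2}$, where $\rho(X,Y)$ is the Pearson correlation between $X$ and $Y$. Pseudometric. A function $d:\mathcal{X}\times\mathcal{X}\to[0,\infty]$ is a pseudometric if $d(x,x)=0$,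 $d(x,y)=d(y,x)$, and $d(x,z)\le d(x,y)+d(y,z)$ for all $x,y,z\in\mathcal{X}$.
   Formalization: "All reward functions" is restricted to those for which the expectation in C_T(R)(S,A,S') exists almost surely and C_T(R)(S,A,S') is a random variable of finite nonzero variance; otherwise (e.g. R = 0) the Pearson correlation is undefined. *)

theory Defs
  imports "HOL-Probability.Probability"
begin

text \<open>
  Joint law of \<open>(A\<^sub>0, S\<^sub>1, S\<^sub>2)\<close>, where \<open>A\<^sub>0\<close> has law \<open>DA\<close> and, given \<open>A\<^sub>0\<close>, the next states
  \<open>S\<^sub>1\<close> and \<open>S\<^sub>2\<close> are drawn independently from \<open>T s A\<^sub>0\<close> and \<open>T s' A\<^sub>0\<close>. The same \<open>A\<^sub>0\<close> is
  used for both draws.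
\<close>

definition dynamics_law ::
  "'s measure \<Rightarrow> 'a measure \<Rightarrow> ('s \<Rightarrow> 'a \<Rightarrow> 's measure) \<Rightarrow> 'a measure \<Rightarrow> 's \<Rightarrow> 's
    \<Rightarrow> ('a \<times> 's \<times> 's) measure" where
  "dynamics_law SM AM T DA s s' =
     DA \<bind> (\<lambda>a\<^sub>0. T s a\<^sub>0 \<bind> (\<lambda>s\<^sub>1. T s' a\<^sub>0 \<bind> (\<lambda>s\<^sub>2.
       return (AM \<Otimes>\<^sub>M SM \<Otimes>\<^sub>M SM) (a\<^sub>0, s\<^sub>1, s\<^sub>2))))"

lemma dynamics_law_in_prob_algebra:
  assumes "DA \<in> space (prob_algebra AM)"
    and T [measurable]: "case_prod T \<in> SM \<Otimes>\<^sub>M AM \<rightarrow>\<^sub>M prob_algebra SM"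
    and [measurable]: "s \<in> space SM" "s' \<in> space SM"
  shows "dynamics_law SM AM T DA s s' \<in> space (prob_algebra (AM \<Otimes>\<^sub>M SM \<Otimes>\<^sub>M SM))"
proof -
  have K: "(\<lambda>a. T u a) \<in> AM \<rightarrow>\<^sub>M prob_algebra SM" if "u \<in> space SM" for u
    using measurable_compose[OF measurable_Pair1'[OF that] T] by simp
  have [measurable]: "T s \<in> AM \<rightarrow>\<^sub>M prob_algebra SM" "T s' \<in> AM \<rightarrow>\<^sub>M prob_algebra SM"
    using K assms by simp_all
  show ?thesis
    unfolding dynamics_law_def
    by (rule measurable_space[OF _ assms(1),
          of "\<lambda>DA. DA \<bind> (\<lambda>a\<^sub>0. T s a\<^sub>0 \<bind> (\<lambda>s\<^sub>1. T s' a\<^sub>0 \<bind> (\<lambda>s\<^sub>2.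
                return (AM \<Otimes>\<^sub>M SM \<Otimes>\<^sub>M SM) (a\<^sub>0, s\<^sub>1, s\<^sub>2))))"]) measurable
qed

definition dynamics_integrand ::
  "real \<Rightarrow> ('s \<Rightarrow> 'a \<Rightarrow> 's \<Rightarrow> real) \<Rightarrow> 's \<Rightarrow> 's \<Rightarrow> 'a \<times> 's \<times> 's \<Rightarrow> real" where
  "dynamics_integrand \<gamma> R s s' =
     (\<lambda>(a\<^sub>0, s\<^sub>1, s\<^sub>2). \<gamma> * R s' a\<^sub>0 s\<^sub>2 - R s a\<^sub>0 s\<^sub>1 - \<gamma> * R s\<^sub>1 a\<^sub>0 s\<^sub>2)"

definition dynamics_transform ::
  "real \<Rightarrow> 's measure \<Rightarrow> 'a measure \<Rightarrow> ('s \<Rightarrow> 'a \<Rightarrow> 's measure) \<Rightarrow> 'a measure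
    \<Rightarrow> ('s \<Rightarrow> 'a \<Rightarrow> 's \<Rightarrow> real) \<Rightarrow> 's \<Rightarrow> 'a \<Rightarrow> 's \<Rightarrow> real" where
  "dynamics_transform \<gamma> SM AM T DA R s a s' =
     R s a s' + (\<integral>x. dynamics_integrand \<gamma> R s s' x \<partial>dynamics_law SM AM T DA s s')"

definition covariance :: "'w measure \<Rightarrow> ('w \<Rightarrow> real) \<Rightarrow> ('w \<Rightarrow> real) \<Rightarrow> real" where
  "covariance M X Y =
     (\<integral>w. (X w - integral\<^sup>L M X) * (Y w - integral\<^sup>L M Y) \<partial>M)"

definition pearson_correlation :: "'w measure \<Rightarrow> ('w \<Rightarrow> real) \<Rightarrow> ('w \<Rightarrow> real) \<Rightarrow> real" where
  "pearson_correlation M X Y =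
     covariance M X Y / (sqrt (covariance M X X) * sqrt (covariance M Y Y))"

text \<open>
  The random variables that have Pearson correlations: finite, nonzero variance. (If the variance
  vanishes, the quotient in \<open>pearson_correlation\<close> is \<open>0/0\<close>, which HOL evaluates to \<open>0\<close>.)
\<close>

definition has_pearson :: "'w measure \<Rightarrow> ('w \<Rightarrow> real) \<Rightarrow> bool" where
  "has_pearson M X \<longleftrightarrow>
     X \<in> borel_measurable M \<and> integrable M (\<lambda>w. (X w)\<^sup>2) \<and> covariance M X X \<noteq> 0"

definition pearson_distance :: "'w measure \<Rightarrow> ('w \<Rightarrow> real) \<Rightarrow> ('w \<Rightarrow> real) \<Rightarrow> real" where
  "pearson_distance M X Y = sqrt (1 - pearson_correlation M X Y) / sqrt 2"

definition dard_distance ::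
  "real \<Rightarrow> 's measure \<Rightarrow> 'a measure \<Rightarrow> ('s \<Rightarrow> 'a \<Rightarrow> 's measure) \<Rightarrow> 'a measure
    \<Rightarrow> 'w measure \<Rightarrow> ('w \<Rightarrow> 's) \<Rightarrow> ('w \<Rightarrow> 'a) \<Rightarrow> ('w \<Rightarrow> 's)
    \<Rightarrow> ('s \<Rightarrow> 'a \<Rightarrow> 's \<Rightarrow> real) \<Rightarrow> ('s \<Rightarrow> 'a \<Rightarrow> 's \<Rightarrow> real) \<Rightarrow> real" where
  "dard_distance \<gamma> SM AM T DA M S A S' R\<^sub>A R\<^sub>B =
     pearson_distance M
       (\<lambda>w. dynamics_transform \<gamma> SM AM T DA R\<^sub>A (S w) (A w) (S' w))
       (\<lambda>w. dynamics_transform \<gamma> SM AM T DA R\<^sub>B (S w) (A w) (S' w))"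

text \<open>
  The reward functions for which \<open>dard_distance\<close> is meaningful: the expectation in the
  transformation exists for almost every sampled transition, and the transformed reward of the
  sampled transition has Pearson correlations. Integrability has to be required explicitly because
  the integral of a non-integrable function is \<open>0\<close> in HOL.
\<close>

definition dard_rewards ::
  "real \<Rightarrow> 's measure \<Rightarrow> 'a measure \<Rightarrow> ('s \<Rightarrow> 'a \<Rightarrow> 's measure) \<Rightarrow> 'a measure
    \<Rightarrow> 'w measure \<Rightarrow> ('w \<Rightarrow> 's) \<Rightarrow> ('w \<Rightarrow> 'a) \<Rightarrow> ('w \<Rightarrow> 's)
    \<Rightarrow> ('s \<Rightarrow> 'a \<Rightarrow> 's \<Rightarrow> real) set" where
  "dard_rewards \<gamma> SM AM T DA M S A S' =
     {R. (AE w in M. integrable (dynamics_law SM AM T DA (S w) (S' w))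
                       (dynamics_integrand \<gamma> R (S w) (S' w))) \<and>
         has_pearson M (\<lambda>w. dynamics_transform \<gamma> SM AM T DA R (S w) (A w) (S' w))}"

definition pseudometric_on :: "'x set \<Rightarrow> ('x \<Rightarrow> 'x \<Rightarrow> real) \<Rightarrow> bool" where
  "pseudometric_on X d \<longleftrightarrow>
     (\<forall>x\<in>X. \<forall>y\<in>X. 0 \<le> d x y) \<and>
     (\<forall>x\<in>X. d x x = 0) \<and>
     (\<forall>x\<in>X. \<forall>y\<in>X. d x y = d y x) \<and>
     (\<forall>x\<in>X. \<forall>y\<in>X. \<forall>z\<in>X. d x z \<le> d x y + d y z)"

end

theory Submission
  imports Defs
begin

text \<open>
  Let \<open>Z\<^sub>X\<close> denote the standardization of \<open>X\<close>, with mean \<open>0\<close> and variance \<open>1\<close>. Expanding the square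
  gives \<open>E[(Z\<^sub>X - Z\<^sub>Y)\<^sup>2] = 2 * (1 - \<rho>(X,Y))\<close>, so the Pearson distance is half the \<open>L\<^sup>2\<close> distance of
  the standardizations, and it inherits the pseudometric laws from \<open>L\<^sup>2\<close>. The transformation of the
  rewards plays no role beyond supplying the random variables.
\<close>

text \<open>Since \<open>2 * \<bar>u * v\<bar> \<le> u\<^sup>2 + v\<^sup>2\<close>, the product is
  dominated by an integrable sum of squares. This controls every cross term below.\<close>

lemma integrable_mult_of_square:
  fixes f g :: "'w \<Rightarrow> real"
  assumes [measurable]: "f \<in> borel_measurable M" "g \<in> borel_measurable M"
    and "integrable M (\<lambda>x. (f x)\<^sup>2)" "integrable M (\<lambda>x. (g x)\<^sup>2)"
  shows "integrable M (\<lambda>x. f x * g x)"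
proof (rule Bochner_Integration.integrable_bound)
  show "integrable M (\<lambda>x. (f x)\<^sup>2 + (g x)\<^sup>2)"
    using assms by simp
  have "\<bar>f x * g x\<bar> \<le> (f x)\<^sup>2 + (g x)\<^sup>2" for x
  proof -
    have "2 * \<bar>f x * g x\<bar> \<le> (f x)\<^sup>2 + (g x)\<^sup>2"
      using sum_squares_bound[of "\<bar>f x\<bar>" "\<bar>g x\<bar>"] by (simp add: abs_mult)
    then show ?thesis
      using abs_ge_zero[of "f x * g x"] by linarith
  qed
  then show "AE x in M. norm (f x * g x) \<le> norm ((f x)\<^sup>2 + (g x)\<^sup>2)"
    by simp
qed measurable

text \<open>The integral of \<open>(f - t * g)\<^sup>2\<close> is a nonnegative polynomial in
  \<open>t\<close> of degree at most two; evaluating it at a suitable \<open>t\<close> gives the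
  bound.\<close>

lemma Cauchy_Schwarz_integral:
  fixes f g :: "'w \<Rightarrow> real"
  assumes f: "f \<in> borel_measurable M" "integrable M (\<lambda>x. (f x)\<^sup>2)"
    and g: "g \<in> borel_measurable M" "integrable M (\<lambda>x. (g x)\<^sup>2)"
  shows "(\<integral>x. f x * g x \<partial>M)\<^sup>2 \<le> (\<integral>x. (f x)\<^sup>2 \<partial>M) * (\<integral>x. (g x)\<^sup>2 \<partial>M)"
proof -
  define a b c where "a = (\<integral>x. (f x)\<^sup>2 \<partial>M)" and "b = (\<integral>x. (g x)\<^sup>2 \<partial>M)"
    and "c = (\<integral>x. f x * g x \<partial>M)"
  have fg: "integrable M (\<lambda>x. f x * g x)"
    using f g by (intro integrable_mult_of_square)
  have quad: "0 \<le> a - 2 * t * c + t\<^sup>2 * b" for t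
  proof -
    have "0 \<le> (\<integral>x. (f x - t * g x)\<^sup>2 \<partial>M)"
      by simp
    also have "\<dots> = (\<integral>x. (f x)\<^sup>2 - 2 * t * (f x * g x) + t\<^sup>2 * (g x)\<^sup>2 \<partial>M)"
      by (simp add: power2_eq_square algebra_simps)
    also have "\<dots> = a - 2 * t * c + t\<^sup>2 * b"
      using f g fg by (simp add: a_def b_def c_def)
    finally show ?thesis .
  qed
  have "c\<^sup>2 \<le> a * b"
  proof (cases "b = 0")
    case True
    \<comment> \<open>For \<open>b = 0\<close> the polynomial is \<open>a - 2 * t * c\<close>. If
      \<open>c\<close> were nonzero, the chosen \<open>t\<close> would give it the value -1.\<close>
    have "c = 0"
      using quad[of "(a + 1) / (2 * c)"] True by (rule_tac ccontr) (simp add: field_simps)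
    with True show ?thesis by simp
  next
    case False
    then have "0 < b"
      by (simp add: b_def order_less_le)
    \<comment> \<open>The minimizer \<open>t = c / b\<close> turns nonnegativity into
      \<open>0 \<le> a - c\<^sup>2 / b\<close>.\<close>
    then show ?thesis
      using quad[of "c / b"] by (simp add: power2_eq_square field_simps)
  qed
  then show ?thesis
    by (simp add: a_def b_def c_def)
qed

text \<open>After expanding the square, Cauchy-Schwarz bounds the cross term by the one in
  \<open>(sqrt a + sqrt b)\<^sup>2\<close>.\<close>

lemma Minkowski_integral:
  fixes f g :: "'w \<Rightarrow> real"
  assumes f: "f \<in> borel_measurable M" "integrable M (\<lambda>x. (f x)\<^sup>2)"
    and g: "g \<in> borel_measurable M" "integrable M (\<lambda>x. (g x)\<^sup>2)"
  shows "sqrt (\<integral>x. (f x + g x)\<^sup>2 \<partial>M) \<le> sqrt (\<integral>x. (f x)\<^sup>2 \<partial>M) + sqrt (\<integral>x. (g x)\<^sup>2 \<partial>M)"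
proof -
  define a b c where "a = (\<integral>x. (f x)\<^sup>2 \<partial>M)" and "b = (\<integral>x. (g x)\<^sup>2 \<partial>M)"
    and "c = (\<integral>x. f x * g x \<partial>M)"
  have fg: "integrable M (\<lambda>x. f x * g x)"
    using f g by (intro integrable_mult_of_square)
  have nonneg: "0 \<le> a" "0 \<le> b"
    by (simp_all add: a_def b_def)
  have "c\<^sup>2 \<le> a * b"
    using Cauchy_Schwarz_integral[OF f g] by (simp add: a_def b_def c_def)
  then have c: "c \<le> sqrt a * sqrt b"
    by (metis real_le_rsqrt real_sqrt_mult)
  have "(\<integral>x. (f x + g x)\<^sup>2 \<partial>M) = (\<integral>x. (f x)\<^sup>2 + 2 * (f x * g x) + (g x)\<^sup>2 \<partial>M)"
    by (simp add: power2_eq_square algebra_simps)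
  also have "\<dots> = a + 2 * c + b"
    using f g fg by (simp add: a_def b_def c_def)
  also have "\<dots> \<le> (sqrt a + sqrt b)\<^sup>2"
    using c nonneg by (simp add: power2_sum)
  finally show ?thesis
    unfolding a_def[symmetric] b_def[symmetric]
    using nonneg by (intro real_le_lsqrt) auto
qed

lemma covariance_commute: "covariance M X Y = covariance M Y X"
  by (simp add: covariance_def mult.commute)

lemma pearson_distance_commute: "pearson_distance M X Y = pearson_distance M Y X"
  by (simp add: pearson_distance_def pearson_correlation_def covariance_commute[of M X Y] mult.commute)

definition standardize :: "'w measure \<Rightarrow> ('w \<Rightarrow> real) \<Rightarrow> 'w \<Rightarrow> real" where
  "standardize M X w = (X w - integral\<^sup>L M X) / sqrt (covariance M X X)"

context prob_space
begin

lemma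
  assumes "has_pearson M X"
  shows measurable_standardize: "standardize M X \<in> borel_measurable M"
    and integrable_standardize_square: "integrable M (\<lambda>w. (standardize M X w)\<^sup>2)"
    and covariance_self_pos: "0 < covariance M X X"
proof -
  have X [measurable]: "X \<in> borel_measurable M" and sq: "integrable M (\<lambda>w. (X w)\<^sup>2)"
    and nz: "covariance M X X \<noteq> 0"
    using assms by (auto simp: has_pearson_def)
  \<comment> \<open>Finite total mass gives integrability of \<open>X\<close> from that of its
    square, and also makes the constant term of the expanded centred square integrable.\<close>
  have "integrable M X"
    using X sq by (rule square_integrable_imp_integrable)
  with sq have "integrable M (\<lambda>w. (X w - integral\<^sup>L M X)\<^sup>2)"
    by (simp add: power2_diff)
  then show "integrable M (\<lambda>w. (standardize M X w)\<^sup>2)"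
    by (simp add: standardize_def power_divide)
  show "standardize M X \<in> borel_measurable M"
    unfolding standardize_def[abs_def] by measurable
  have "0 \<le> covariance M X X"
    by (simp add: covariance_def)
  with nz show "0 < covariance M X X"
    by simp
qed

text \<open>Constant factors leave the integral even when the integrand is not integrable. If a
  variance vanishes, division by zero makes both sides 0, so the identity is unconditional.\<close>

lemma pearson_correlation_standardize:
  "pearson_correlation M X Y = (\<integral>w. standardize M X w * standardize M Y w \<partial>M)"
  by (simp add: pearson_correlation_def covariance_def[of M X Y] standardize_def)

text \<open>Nonzero variance is essential: otherwise the quotient would be 0 and \<open>X\<close>
  would lie at distance \<open>1 / sqrt 2\<close> from itself.\<close>

lemma pearson_correlation_self:
  assumes "has_pearson M X"
  shows "pearson_correlation M X X = 1"
  using covariance_self_pos[OF assms] by (simp add: pearson_correlation_def)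

lemma pearson_distance_eq_L2:
  assumes X: "has_pearson M X" and Y: "has_pearson M Y"
  shows "pearson_distance M X Y =
    sqrt (\<integral>w. (standardize M X w - standardize M Y w)\<^sup>2 \<partial>M) / 2"
proof -
  note int = integrable_standardize_square[OF X] integrable_standardize_square[OF Y]
    integrable_mult_of_square[OF measurable_standardize[OF X] measurable_standardize[OF Y]
      integrable_standardize_square[OF X] integrable_standardize_square[OF Y]]
  have self: "(\<integral>w. (standardize M Z w)\<^sup>2 \<partial>M) = 1" if "has_pearson M Z" for Z
    using pearson_correlation_self[OF that]
    by (simp add: pearson_correlation_standardize power2_eq_square)
  have "(\<integral>w. (standardize M X w - standardize M Y w)\<^sup>2 \<partial>M) =
    (\<integral>w. (standardize M X w)\<^sup>2 + (standardize M Y w)\<^sup>2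
      - 2 * (standardize M X w * standardize M Y w) \<partial>M)"
    by (simp add: power2_diff mult.assoc)
  also have "\<dots> = 2 * (1 - pearson_correlation M X Y)"
    using int by (simp add: self X Y pearson_correlation_standardize)
  finally have "(\<integral>w. (standardize M X w - standardize M Y w)\<^sup>2 \<partial>M) =
    2 * (1 - pearson_correlation M X Y)" .
  \<comment> \<open>Splitting the root leaves
    \<open>sqrt 2 * sqrt (1 - pearson_correlation M X Y) / 2\<close>, and
    \<open>2 = sqrt 2 * sqrt 2\<close> cancels one factor.\<close>
  then show ?thesis
    unfolding pearson_distance_def by (simp only: real_sqrt_mult) (simp add: field_simps)
qed

text \<open>The difference of the standardizations of \<open>X\<close> and \<open>Z\<close>
  telescopes through that of \<open>Y\<close>, so Minkowski applies to the two summands.\<close>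

lemma pearson_distance_triangle:
  assumes X: "has_pearson M X" and Y: "has_pearson M Y" and Z: "has_pearson M Z"
  shows "pearson_distance M X Z \<le> pearson_distance M X Y + pearson_distance M Y Z"
proof -
  have diff: "(\<lambda>w. standardize M U w - standardize M V w) \<in> borel_measurable M"
      "integrable M (\<lambda>w. (standardize M U w - standardize M V w)\<^sup>2)"
    if U: "has_pearson M U" and V: "has_pearson M V" for U V
    using integrable_mult_of_square[OF measurable_standardize[OF U] measurable_standardize[OF V]]
      measurable_standardize[OF U] measurable_standardize[OF V]
      integrable_standardize_square[OF U] integrable_standardize_square[OF V]
    by (simp_all add: power2_diff mult.assoc)
  show ?thesis
    using Minkowski_integral[OF diff[OF X Y] diff[OF Y Z]]
    by (simp add: pearson_distance_eq_L2 X Y Z)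
qed

lemma pseudometric_on_pearson_distance:
  "pseudometric_on {X. has_pearson M X} (pearson_distance M)"
  unfolding pseudometric_on_def
proof (intro conjI ballI; unfold mem_Collect_eq)
  fix X Y Z
  assume X: "has_pearson M X"
  show "pearson_distance M X X = 0"
    by (simp add: pearson_distance_eq_L2 X)
  assume Y: "has_pearson M Y"
  show "0 \<le> pearson_distance M X Y"
    by (simp add: pearson_distance_eq_L2 X Y)
  show "pearson_distance M X Y = pearson_distance M Y X"
    by (rule pearson_distance_commute)
  assume "has_pearson M Z"
  with X Y show "pearson_distance M X Z \<le> pearson_distance M X Y + pearson_distance M Y Z"
    by (rule pearson_distance_triangle)
qed

end

text \<open>Each law is universally quantified over points, so it transfers along \<open>f\<close>
  even if \<open>f\<close> identifies points; those then have distance 0, which a pseudometric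
  permits.\<close>

lemma pseudometric_on_pullback:
  assumes "pseudometric_on Y d" and "f ` X \<subseteq> Y"
  shows "pseudometric_on X (\<lambda>x x'. d (f x) (f x'))"
proof -
  have "f x \<in> Y" if "x \<in> X" for x
    using assms(2) that by blast
  with assms(1) show ?thesis
    unfolding pseudometric_on_def by simp
qed

theorem proposition4:
  fixes \<gamma> :: real
    and SM :: "'s measure" and AM :: "'a measure"
    and T :: "'s \<Rightarrow> 'a \<Rightarrow> 's measure"
    and DA :: "'a measure"
    and D :: "('s \<times> 'a \<times> 's) measure"
    and M :: "'w measure"
    and S S' :: "'w \<Rightarrow> 's" and A :: "'w \<Rightarrow> 'a"
  assumes "0 \<le> \<gamma>" and "\<gamma> \<le> 1"
    and "case_prod T \<in> SM \<Otimes>\<^sub>M AM \<rightarrow>\<^sub>M prob_algebra SM"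
    and "DA \<in> space (prob_algebra AM)"
    and "D \<in> space (prob_algebra (SM \<Otimes>\<^sub>M AM \<Otimes>\<^sub>M SM))"
    and "prob_space M"
    and "S \<in> M \<rightarrow>\<^sub>M SM" and "A \<in> M \<rightarrow>\<^sub>M AM" and "S' \<in> M \<rightarrow>\<^sub>M SM"
    and "distr M (SM \<Otimes>\<^sub>M AM \<Otimes>\<^sub>M SM) (\<lambda>w. (S w, A w, S' w)) = D"
  shows "pseudometric_on (dard_rewards \<gamma> SM AM T DA M S A S')
           (dard_distance \<gamma> SM AM T DA M S A S')"
proof -
  interpret prob_space M by fact
  \<comment> \<open>The map pulled back along sends a reward to its transform at the sampled
    transition. The second conjunct in \<open>dard_rewards\<close> places its values among the
    variables with Pearson correlations.\<close>
  have "pseudometric_on (dard_rewards \<gamma> SM AM T DA M S A S')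
    (\<lambda>R\<^sub>A R\<^sub>B. pearson_distance M
       (\<lambda>w. dynamics_transform \<gamma> SM AM T DA R\<^sub>A (S w) (A w) (S' w))
       (\<lambda>w. dynamics_transform \<gamma> SM AM T DA R\<^sub>B (S w) (A w) (S' w)))"
    by (rule pseudometric_on_pullback[OF pseudometric_on_pearson_distance])
      (auto simp: dard_rewards_def)
  then show ?thesis
    by (simp add: dard_distance_def[abs_def])
qed

end
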